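(* For all integers $n\geq 1$ and $\alpha\geq 1$, $$S_{n+2^\alpha}\equiv S_{n}+2^{\alpha+1}\pmod{2^{\alpha+2}},$$ where $S_n$ denotes the $n$-th Schröder number.
   Context: For an integer $n\ge 0$, the Schröder number $S_n$ is $$S_n=\sum_{k=0}^n\binom{n}{k}\binom{n+k}{k}\frac{1}{k+1}=\sum_{k=0}^n\binom{n+k}{2k}\binom{2k}{k}\frac{1}{k+1}.$$ It is a positive integer. *)

theory Defs
  imports Complex_Main "HOL-Number_Theory.Number_Theory"
begin

(* The division is exact in every summand (Suc_dvd_schroeder_term below), so "div" computes
   the rational summand of the usual formula; see of_nat_schroeder. *)
definition schroeder :: "nat \<Rightarrow> nat" where
  "schroeder n = (\<Sum>k=0..n. (n choose k) * ((n + k) choose k) div (k + 1))"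

lemma schroeder_term_eq:
  assumes "k \<le> n"
  shows "(n choose k) * ((n + k) choose k) = ((n + k) choose (2 * k)) * ((2 * k) choose k)"
  using choose_mult[of k "2 * k" "n + k"] assms by (simp add: mult.commute)

lemma Suc_dvd_central_binomial: "k + 1 dvd (2 * k) choose k"
proof -
  have "(k + 1) * ((2 * k + 1) choose (k + 1)) = (2 * k + 1) * ((2 * k) choose k)"
    using Suc_times_binomial_eq[of "2 * k" k] by (simp add: mult.commute)
  then have "k + 1 dvd (2 * k + 1) * ((2 * k) choose k)"
    by (metis dvd_triv_left)
  moreover have "coprime (k + 1) (2 * k + 1)"
  proof (rule coprimeI)
    fix d assume d: "d dvd k + 1" "d dvd 2 * k + 1"
    then have "d dvd 2 * (k + 1) - (2 * k + 1)"
      by (meson dvd_diff_nat dvd_mult)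
    then show "is_unit d" by simp
  qed
  ultimately show ?thesis
    by (simp only: coprime_dvd_mult_right_iff)
qed

lemma Suc_dvd_schroeder_term:
  assumes "k \<le> n"
  shows "k + 1 dvd (n choose k) * ((n + k) choose k)"
  unfolding schroeder_term_eq[OF assms] using Suc_dvd_central_binomial by (rule dvd_mult)

lemma of_nat_schroeder:
  "(of_nat (schroeder n) :: rat) =
     (\<Sum>k=0..n. of_nat (n choose k) * of_nat ((n + k) choose k) * (1 / of_nat (k + 1)))"
proof -
  have "(of_nat ((n choose k) * ((n + k) choose k) div (k + 1)) :: rat) =
      of_nat (n choose k) * of_nat ((n + k) choose k) * (1 / of_nat (k + 1))" if "k \<le> n" for k
    using of_nat_of_nat_div[OF Suc_dvd_schroeder_term[OF that], where 'a = rat] by simp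
  then show ?thesis
    unfolding schroeder_def of_nat_sum by (intro sum.cong) auto
qed

lemma of_nat_schroeder':
  "(of_nat (schroeder n) :: rat) =
     (\<Sum>k=0..n. of_nat ((n + k) choose (2 * k)) * of_nat ((2 * k) choose k) * (1 / of_nat (k + 1)))"
  unfolding of_nat_schroeder
proof (rule sum.cong)
  fix k assume "k \<in> {0..n}"
  then show "(of_nat (n choose k) * of_nat ((n + k) choose k) * (1 / of_nat (k + 1)) :: rat) =
      of_nat ((n + k) choose (2 * k)) * of_nat ((2 * k) choose k) * (1 / of_nat (k + 1))"
    unfolding of_nat_mult[symmetric] by (simp only: schroeder_term_eq atLeastAtMost_iff)
qed simp

lemma schroeder_pos: "schroeder n > 0"
proof -
  have "(n choose 0) * ((n + 0) choose 0) div (0 + 1) \<le> schroeder n"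
    unfolding schroeder_def by (rule member_le_sum) auto
  then show ?thesis by simp
qed

end

theory Submission
  imports Defs
begin

text \<open>
  The formula defining \<^term>\<open>schroeder n\<close> contains no powers of \<open>2\<close>, so the proof starts by
  rewriting it in terms of Narayana numbers:
  \[ S_{m+1} = \sum_{j} 2^{j+1} N_j(m), \qquad
     N_j(m) = \frac{1}{m+2} {m+2 \choose j+1} {m \choose j}
            = {m \choose j}^2 - {m \choose j-1} {m \choose j+1}. \]
  The first equality is a double count (\<open>Suc_times_schroeder\<close>): expand \<open>n+k\<close> choose \<open>n\<close> by
  Vandermonde's identity and sum over \<open>k\<close> first, which produces the powers of \<open>2\<close>. The last
  form of \<open>N_j\<close> is what makes 2-adic estimates possible, because it has no denominator and
  involves only binomial coefficients with lower index at most \<open>j+1\<close>.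

  Put \<open>h = 2^\<alpha>\<close>. Replacing \<open>m\<close> by \<open>m+h\<close> changes \<open>m\<close> choose \<open>i\<close> by a combination of the numbers
  \<open>h\<close> choose \<open>l\<close> with \<open>0 < l \<le> i\<close>. Such a number is divisible by \<open>h\<close> up to the power of \<open>2\<close> in \<open>l\<close>,
  and for \<open>l < 2^j\<close> the factor \<open>2^j\<close> more than repays this loss
  (\<open>two_power_dvd_times_binomial\<close>). As \<open>j+1 < 2^j\<close> for \<open>j \<ge> 2\<close>, all summands with \<open>j \<ge> 2\<close> are
  unchanged modulo \<open>4h\<close>. The summand for \<open>j = 0\<close> is constant, and the one for \<open>j = 1\<close> is
  \<open>2m(m+1)\<close>, which changes by \<open>2h(2m+h+1)\<close>. This is \<open>2h\<close> modulo \<open>4h\<close> since \<open>h\<close> is even, and it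
  is the whole change of the Schroeder number.
\<close>

section \<open>Narayana numbers\<close>

text \<open>
  In the usual notation this is the Narayana number \<open>N(m+1, j+1)\<close>, given by its
  two-by-two determinant of binomial coefficients.
\<close>

fun narayana :: "nat \<Rightarrow> nat \<Rightarrow> int" where
  "narayana m 0 = 1"
| "narayana m (Suc j) =
     int (m choose Suc j) ^ 2 - int (m choose j) * int (m choose Suc (Suc j))"

lemma narayana_eq_0:
  assumes "j > m"
  shows "narayana m j = 0"
  using assms by (cases j) (simp_all add: binomial_eq_0)

lemma int_Suc_times_binomial_Suc:
  "(int j + 1) * int (m choose Suc j) = (int m - int j) * int (m choose j)"
proof (cases "j \<le> m")
  case True
  have "Suc j * (m choose Suc j) = (m - j) * (m choose j)"
    using binomial_absorb_comp[of m j] binomial_absorption[of j m] by simp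
  then have "int (Suc j) * int (m choose Suc j) = int (m - j) * int (m choose j)"
    by (metis of_nat_mult)
  then show ?thesis
    using True by (simp add: of_nat_diff add.commute)
next
  case False
  then show ?thesis by (simp add: binomial_eq_0)
qed

text \<open>
  With \<open>a, b, c\<close> for three neighbouring entries of row \<open>m\<close> of Pascal's triangle, the upper index
  \<open>m+2\<close> yields \<open>a + 2b + c\<close>, and the claim becomes a consequence of the two relations between
  consecutive entries.
\<close>

lemma times_narayana:
  "int (m + 2) * narayana m j = int ((m + 2) choose (j + 1)) * int (m choose j)"
proof (cases j)
  case 0
  then show ?thesis by simp
next
  case (Suc i)
  define a b c where "a = int (m choose i)" and "b = int (m choose Suc i)"
    and "c = int (m choose Suc (Suc i))"
  have ab: "(int i + 1) * b = (int m - int i) * a"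
    unfolding a_def b_def by (rule int_Suc_times_binomial_Suc)
  have bc: "(int i + 2) * c = (int m - int i - 1) * b"
    using int_Suc_times_binomial_Suc[of "Suc i" m] unfolding c_def b_def
    by (simp add: algebra_simps)
  have row: "int ((m + 2) choose (j + 1)) = a + 2 * b + c"
    unfolding a_def b_def c_def Suc by (simp add: numeral_2_eq_2)
  have "int (m + 2) * (b\<^sup>2 - a * c) = (a + 2 * b + c) * b"
  proof -
    have "int (m + 2) * (b\<^sup>2 - a * c) - (a + 2 * b + c) * b =
        (b + c) * ((int i + 1) * b - (int m - int i) * a)
        - (a + b) * ((int i + 2) * c - (int m - int i - 1) * b)"
      by (simp add: algebra_simps power2_eq_square)
    then show ?thesis
      by (simp only: ab bc diff_self mult_zero_right right_minus_eq)
  qed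
  then show ?thesis
    unfolding row by (simp only: Suc narayana.simps a_def b_def c_def)
qed

section \<open>Schroeder numbers as sums of Narayana numbers\<close>

lemma Suc_times_schroeder_binomial:
  "(n + 1) * schroeder n = (\<Sum>k\<le>n. ((n + 1) choose (k + 1)) * ((n + k) choose n))"
proof -
  have "(n + 1) * ((n choose k) * ((n + k) choose k) div (k + 1)) =
      ((n + 1) choose (k + 1)) * ((n + k) choose n)" if "k \<le> n" for k
  proof -
    have "(k + 1) * ((n + 1) * ((n choose k) * ((n + k) choose k) div (k + 1))) =
        (n + 1) * ((n choose k) * ((n + k) choose k))"
      using Suc_dvd_schroeder_term[OF that] by (metis dvd_mult_div_cancel mult.left_commute)
    also have "\<dots> = ((n + 1) * (n choose k)) * ((n + k) choose n)"
      using binomial_symmetric[of k "n + k"] by (simp only: mult.assoc le_add2 diff_add_inverse2)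
    also have "(n + 1) * (n choose k) = (k + 1) * ((n + 1) choose (k + 1))"
      using Suc_times_binomial_eq[of n k] by (simp add: mult.commute)
    finally have "(k + 1) * ((n + 1) * ((n choose k) * ((n + k) choose k) div (k + 1))) =
        (k + 1) * (((n + 1) choose (k + 1)) * ((n + k) choose n))"
      by (simp only: mult.assoc)
    then show ?thesis
      by (subst (asm) mult_cancel1) simp
  qed
  then show ?thesis
    unfolding schroeder_def sum_distrib_left by (intro sum.cong) auto
qed

lemma sum_binomial_times_binomial:
  assumes "i \<le> N"
  shows "(\<Sum>k\<le>N. (N choose k) * (k choose i)) = (N choose i) * 2 ^ (N - i)"
proof -
  have "(\<Sum>k\<le>N. (N choose k) * (k choose i)) = (\<Sum>k=i..N. (N choose k) * (k choose i))"
    by (rule sum.mono_neutral_right) (auto simp: binomial_eq_0)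
  also have "\<dots> = (\<Sum>k=i..N. (N choose i) * ((N - i) choose (k - i)))"
    by (intro sum.cong) (auto simp: choose_mult)
  also have "\<dots> = (\<Sum>k=0..N - i. (N choose i) * ((N - i) choose k))"
    by (rule sum.reindex_bij_witness[where i = "\<lambda>k. k + i" and j = "\<lambda>k. k - i"])
      (use assms in auto)
  also have "\<dots> = (N choose i) * 2 ^ (N - i)"
    by (simp add: sum_distrib_left[symmetric] choose_row_sum atLeast0AtMost)
  finally show ?thesis .
qed

text \<open>
  Both sides compute the coefficient of \<open>x^n\<close> in \<open>((1+x)/(1-x))^(n+1)\<close> for \<open>n = m+1\<close>, the right
  hand side after writing the base as \<open>1 + 2x/(1-x)\<close>. The proof does this by splitting
  \<open>n+k = (k+1) + m\<close> in Vandermonde's identity and summing over \<open>k\<close> first.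
\<close>

lemma Suc_times_schroeder:
  "(m + 2) * schroeder (m + 1) =
     (\<Sum>j\<le>m + 1. 2 ^ (j + 1) * (((m + 2) choose (j + 1)) * (m choose j)))"
proof -
  let ?n = "m + 1"
  let ?V = "\<lambda>k. \<Sum>i\<le>?n. (k choose i) * (m choose (?n - i))"
  have "(m + 2) * schroeder ?n = (\<Sum>k\<le>?n. ((m + 2) choose (k + 1)) * ((?n + k) choose ?n))"
    using Suc_times_schroeder_binomial[of ?n] by (simp add: numeral_2_eq_2)
  also have "\<dots> = (\<Sum>k\<le>?n. ((m + 2) choose (Suc k)) * ?V (Suc k))"
    using vandermonde[of "Suc k" m ?n for k] by (intro sum.cong) (simp_all add: add_ac)
  \<comment> \<open>The term \<open>k = 0\<close> may be added, as then \<open>i = 0\<close> and the lower index \<open>m + 1\<close> exceeds \<open>m\<close>.\<close>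
  also have "\<dots> = (\<Sum>k\<le>m + 2. ((m + 2) choose k) * ?V k)"
  proof -
    have "?V 0 = 0"
      by (intro sum.neutral) (auto simp: binomial_eq_0_iff)
    then show ?thesis
      using sum.atMost_Suc_shift[of "\<lambda>k. ((m + 2) choose k) * ?V k" ?n] by simp
  qed
  also have "\<dots> = (\<Sum>i\<le>?n. (\<Sum>k\<le>m + 2. ((m + 2) choose k) * (k choose i)) * (m choose (?n - i)))"
    unfolding sum_distrib_left sum_distrib_right
    by (subst sum.swap) (simp add: mult.assoc)
  also have "\<dots> = (\<Sum>i\<le>?n. ((m + 2) choose i) * 2 ^ (m + 2 - i) * (m choose (?n - i)))"
    by (intro sum.cong) (simp_all only: sum_binomial_times_binomial atMost_iff)
  also have "\<dots> = (\<Sum>j\<le>?n. 2 ^ (j + 1) * (((m + 2) choose (j + 1)) * (m choose j)))"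
  proof (rule sum.reindex_bij_witness[where i = "\<lambda>j. ?n - j" and j = "\<lambda>i. ?n - i"])
    fix i assume "i \<in> {..?n}"
    then have "i \<le> m + 2" "m + 2 - i = (?n - i) + 1"
      by auto
    then show "2 ^ ((?n - i) + 1) * (((m + 2) choose ((?n - i) + 1)) * (m choose (?n - i))) =
        ((m + 2) choose i) * 2 ^ (m + 2 - i) * (m choose (?n - i))"
      using binomial_symmetric[of i "m + 2"] by (simp add: mult_ac)
  qed auto
  finally show ?thesis .
qed

lemma schroeder_eq_sum_narayana:
  assumes "M \<ge> m + 1"
  shows "int (schroeder (m + 1)) = (\<Sum>j\<le>M. 2 ^ (j + 1) * narayana m j)"
proof -
  have "int ((m + 2) * schroeder (m + 1)) =
      (\<Sum>j\<le>m + 1. 2 ^ (j + 1) * (int ((m + 2) choose (j + 1)) * int (m choose j)))"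
    unfolding Suc_times_schroeder
    by (simp only: of_nat_sum of_nat_mult of_nat_power of_nat_numeral)
  also have "\<dots> = int (m + 2) * (\<Sum>j\<le>m + 1. 2 ^ (j + 1) * narayana m j)"
    unfolding times_narayana[symmetric] sum_distrib_left
    by (simp only: mult.left_commute)
  finally have "int (schroeder (m + 1)) = (\<Sum>j\<le>m + 1. 2 ^ (j + 1) * narayana m j)"
    unfolding of_nat_mult by (subst (asm) mult_cancel_left) simp
  also have "\<dots> = (\<Sum>j\<le>M. 2 ^ (j + 1) * narayana m j)"
    using assms by (intro sum.mono_neutral_left) (auto simp: narayana_eq_0)
  finally show ?thesis .
qed

section \<open>Shifting the upper index by a power of two\<close>

text \<open>
  Since \<open>l\<close> times \<open>h\<close> choose \<open>l\<close> is a multiple of \<open>h\<close>, the only loss is the power of \<open>2\<close>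
  in \<open>l\<close>, whose exponent is less than \<open>j\<close>.
\<close>

lemma two_power_dvd_times_binomial:
  fixes l j \<alpha> :: nat
  assumes "0 < l" and "l < 2 ^ j"
  shows "2 ^ (\<alpha> + 1) dvd 2 ^ j * ((2 ^ \<alpha>) choose l)"
proof -
  define v where "v = multiplicity 2 l"
  obtain u where l: "l = 2 ^ v * u" and u: "\<not> 2 dvd u"
    using multiplicity_decompose'[of l 2] assms(1) unfolding v_def
    by (metis bot_nat_0.not_eq_extremum nat_dvd_1_iff_1 numeral_eq_one_iff semiring_norm(85))
  have "u > 0"
    using u by (cases u) auto
  then have "(2::nat) ^ v \<le> l"
    by (simp add: l)
  then have "(2::nat) ^ v < 2 ^ j"
    using assms(2) by (rule le_less_trans)
  then have "v < j"
    by simp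
  then have j: "(2::nat) ^ j = 2 * (2 ^ (j - Suc v) * 2 ^ v)"
    by (simp flip: power_Suc power_add)
  have "l * ((2 ^ \<alpha>) choose l) = 2 ^ \<alpha> * ((2 ^ \<alpha> - 1) choose (l - 1))"
    using times_binomial_minus1_eq[OF assms(1), of "2 ^ \<alpha>"] .
  then have "u * (2 ^ j * ((2 ^ \<alpha>) choose l)) =
      2 ^ (\<alpha> + 1) * (2 ^ (j - Suc v) * ((2 ^ \<alpha> - 1) choose (l - 1)))"
    unfolding j by (simp add: l mult_ac)
  then have "2 ^ (\<alpha> + 1) dvd u * (2 ^ j * ((2 ^ \<alpha>) choose l))"
    by simp
  moreover have "coprime (2 ^ (\<alpha> + 1)) u"
    using u by simp
  ultimately show ?thesis
    by (simp only: coprime_dvd_mult_right_iff)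
qed

lemma two_power_times_binomial_shift_cong:
  fixes i j m \<alpha> :: nat
  assumes "i < 2 ^ j"
  shows "[2 ^ j * ((m + 2 ^ \<alpha>) choose i) = 2 ^ j * (m choose i)] (mod 2 ^ (\<alpha> + 1))"
proof -
  let ?t = "\<lambda>l. 2 ^ j * (((2 ^ \<alpha>) choose l) * (m choose (i - l)))"
  have "2 ^ j * ((m + 2 ^ \<alpha>) choose i) = (\<Sum>l\<le>i. ?t l)"
    unfolding add.commute[of m] vandermonde[symmetric] sum_distrib_left ..
  also have "\<dots> = ?t 0 + (\<Sum>l\<in>{..i} - {0}. ?t l)"
    by (rule sum.remove) auto
  finally have eq: "2 ^ j * ((m + 2 ^ \<alpha>) choose i) = 2 ^ j * (m choose i) + (\<Sum>l\<in>{..i} - {0}. ?t l)"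
    by simp
  have "2 ^ (\<alpha> + 1) dvd (\<Sum>l\<in>{..i} - {0}. ?t l)"
  proof (rule dvd_sum)
    fix l assume "l \<in> {..i} - {0}"
    then have "2 ^ (\<alpha> + 1) dvd 2 ^ j * ((2 ^ \<alpha>) choose l)"
      using assms by (intro two_power_dvd_times_binomial) auto
    then show "2 ^ (\<alpha> + 1) dvd ?t l"
      unfolding mult.assoc[symmetric] by (rule dvd_mult2)
  qed
  then show ?thesis
    unfolding eq by (simp add: cong_def mod_add_right_eq[symmetric] dvd_imp_mod_0)
qed

lemma cong_scaled_mult:
  fixes c x x' y y' k :: int
  assumes "[c * x = c * x'] (mod k)" and "[c * y = c * y'] (mod k)"
  shows "[c * (x * y) = c * (x' * y')] (mod k)"
proof -
  have "[c * x * y = c * x' * y] (mod k)"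
    using assms(1) by (rule cong_mult) simp
  moreover have "[c * y * x' = c * y' * x'] (mod k)"
    using assms(2) by (rule cong_mult) simp
  ultimately show ?thesis
    by (metis cong_trans mult.assoc mult.commute)
qed

lemma narayana_shift_cong:
  assumes "j \<ge> 2"
  shows "[2 ^ (j + 1) * narayana (m + 2 ^ \<alpha>) j = 2 ^ (j + 1) * narayana m j] (mod 2 ^ (\<alpha> + 2))"
proof -
  obtain i where j: "j = Suc i" and "i \<ge> 1"
    using assms by (cases j) auto
  have "i + 2 < 2 ^ (i + 1)" if "i \<ge> 1" for i :: nat
    using that by (induction i rule: dec_induct) auto
  with \<open>i \<ge> 1\<close> have bound: "Suc (Suc i) < 2 ^ j"
    by (simp add: j)
  have bin: "[2 ^ j * int ((m + 2 ^ \<alpha>) choose r) = 2 ^ j * int (m choose r)] (mod 2 ^ (\<alpha> + 1))"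
    if "r \<le> Suc (Suc i)" for r
    using two_power_times_binomial_shift_cong[of r j m \<alpha>] that bound
    by (simp flip: cong_int_iff)
  have "[2 ^ j * narayana (m + 2 ^ \<alpha>) j = 2 ^ j * narayana m j] (mod 2 ^ (\<alpha> + 1))"
    unfolding j narayana.simps right_diff_distrib power2_eq_square
    by (intro cong_diff cong_scaled_mult bin[unfolded j]) auto
  then have "[2 * (2 ^ j * narayana (m + 2 ^ \<alpha>) j) = 2 * (2 ^ j * narayana m j)]
      (mod 2 * 2 ^ (\<alpha> + 1))"
    by (simp only: cong_def mult_mod_right[symmetric])
  then show ?thesis
    by (simp add: mult.assoc)
qed

text \<open>
  The whole change \<open>2h\<close> comes from here; it needs \<open>h = 2^\<alpha>\<close> to be even, because the change is
  \<open>2h\<close> times \<open>2m+h+1\<close>.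
\<close>

lemma narayana_1_shift_cong:
  assumes "\<alpha> \<ge> 1"
  shows "[4 * narayana (m + 2 ^ \<alpha>) 1 = 4 * narayana m 1 + 2 ^ (\<alpha> + 1)] (mod 2 ^ (\<alpha> + 2))"
proof -
  have val: "4 * narayana r 1 = 2 * int r * (int r + 1)" for r
    using int_Suc_times_binomial_Suc[of 1 r]
    by (simp add: numeral_2_eq_2 power2_eq_square algebra_simps)
  obtain \<beta> where \<alpha>: "\<alpha> = Suc \<beta>"
    using assms by (cases \<alpha>) auto
  have "4 * narayana (m + 2 ^ \<alpha>) 1 - (4 * narayana m 1 + 2 ^ (\<alpha> + 1)) =
      2 ^ (\<alpha> + 2) * (int m + 2 ^ \<beta>)"
    unfolding val \<alpha> by (simp add: algebra_simps)
  then show ?thesis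
    unfolding cong_iff_dvd_diff by simp
qed

section \<open>The congruence\<close>

theorem theorem0p1:
  fixes n \<alpha> :: nat
  assumes "n \<ge> 1" and "\<alpha> \<ge> 1"
  shows "[schroeder (n + 2 ^ \<alpha>) = schroeder n + 2 ^ (\<alpha> + 1)] (mod 2 ^ (\<alpha> + 2))"
proof -
  obtain m where n: "n = m + 1"
    using assms(1) by (metis le_add_diff_inverse2)
  define h :: nat where "h = 2 ^ \<alpha>"
  \<comment> \<open>A common range of summation, long enough for both numbers and containing \<open>0\<close> and \<open>1\<close>.\<close>
  define M where "M = m + h + 1"
  let ?t = "\<lambda>r j. 2 ^ (j + 1) * narayana r j"
  have split: "(\<Sum>j\<le>M. ?t r j) = 2 + 4 * narayana r 1 + (\<Sum>j=2..M. ?t r j)" for r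
  proof -
    have "{..M} = {0, 1} \<union> {2..M}"
      by (auto simp: M_def)
    then show ?thesis
      by (simp add: sum.union_disjoint)
  qed
  have S: "int (schroeder (r + 1)) = 2 + 4 * narayana r 1 + (\<Sum>j=2..M. ?t r j)"
    if "r \<le> m + h" for r
    using that unfolding split[symmetric]
    by (intro schroeder_eq_sum_narayana) (simp add: M_def)
  have "[2 + 4 * narayana (m + h) 1 + (\<Sum>j=2..M. ?t (m + h) j) =
      2 + (4 * narayana m 1 + 2 ^ (\<alpha> + 1)) + (\<Sum>j=2..M. ?t m j)] (mod 2 ^ (\<alpha> + 2))"
    unfolding h_def using assms(2)
    by (intro cong_add cong_sum narayana_1_shift_cong narayana_shift_cong) auto
  then have "[int (schroeder (m + h + 1)) = int (schroeder (m + 1)) + 2 ^ (\<alpha> + 1)]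
      (mod 2 ^ (\<alpha> + 2))"
    unfolding S[OF order_refl] S[OF le_add1] by (simp only: add_ac)
  then have "[int (schroeder (n + 2 ^ \<alpha>)) = int (schroeder n + 2 ^ (\<alpha> + 1))]
      (mod int (2 ^ (\<alpha> + 2)))"
    by (simp add: n h_def add_ac)
  then show ?thesis
    by (simp only: cong_int_iff)
qed

end
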